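(* Let $\mathcal{G}=(\mathcal{V},\mathcal{E})$ be a graph endowed with a unitary connection, $q>0$, $g\in\mathbb{C}^{\mathcal{V}}$, and let $f_*$ be the minimizer over $f\in\mathbb{C}^{\mathcal{V}}$ of $q\|f-g\|_2^2+\langle f,\mathsf{L}_\theta f\rangle$. Fix $i\in\mathcal{V}$ and let $\nu_i$ be the law of the random path $p$ from $i$ to the boundary node $\Gamma$ generated by the interrupted random walk started at $i$. Denoting by $j$ the last node visited by $p$ before reaching $\Gamma$, and writing $p=p_\Gamma e_\Gamma$ with $e_\Gamma=(j,\Gamma)$ the last edge of $p$, one has $$f_*(i)=\mathbf{E}_{p\sim\nu_i}\bigl(\psi_{p_\Gamma^{*}}(g_j)\bigr).$$
   Context: $\mathcal{G}=(\mathcal{V},\mathcal{E})$ is a finite undirected, unweighted graph with adjacency matrix $\mathsf{A}$ and degrees $d_v$; each edge $\{i,j\}$ gives two oriented edges $(i,j),(j,i)$. A unitary connection assigns to each oriented edge $e$ an angle $\theta_e$ with $\theta_{(j,i)}=-\theta_{(i,j)}$ and the map $\psi_e(z)=e^{\iota\theta_e}z$ on $\mathbb{C}$ ($\iota$ the imaginary unit). The connection Laplacian is $\mathsf{L}_\theta=\mathsf{D}-\mathsf{A}_\theta$, with $\mathsf{D}$ the diagonal degree matrix and $(\mathsf{A}_\theta)_{i,j}=e^{-\iota\theta_{(i,j)}}$ if $\{i,j\}\in\mathcal{E}$, $0$ otherwise. A path is an ordered sequence of consecutive oriented edges; $pq$ denotes concatenation and $p^*$ orientation reversal. Connection maps extend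 to paths by $\psi_{pq}=\psi_q\circ\psi_p$ (identity for the empty path); for a path $p$ from $i$ to $j$, $\psi_{p^*}$ is thus the composition of the inverse rotations, mapping the copy of $\mathbb{C}$ at $j$ to that at $i$. The interrupted random walk $(u_t)_{t\ge0}$ lives on the extended graph with nodes $\mathcal{V}\cup\{\Gamma\}$, where $\Gamma$ is an additional node joined to every node of $\mathcal{V}$. It starts at $u_0=i$, and from $u_t\in\mathcal{V}$ moves to $\Gamma$ with probability $\frac{q}{d_{u_t}+q}$ and to $v\in\mathcal{V}$ with probability $\frac{\mathsf{A}_{u_t,v}}{d_{u_t}+q}$; it stops upon reaching $\Gamma$. If $u_l=\Gamma$, the resulting path is $p=((u_0,u_1),\dots,(u_{l-1},u_l))$, and $j=u_{l-1}$. *)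

theory Defs
  imports "HOL-Probability.Probability"
begin

section \<open>Graphs with a unitary connection\<close>

text \<open>The vertex set is the whole finite type \<open>'v\<close>; an undirected edge is the two-element
  set of its endpoints.\<close>

definition simple_graph :: "'v::finite set set \<Rightarrow> bool" where
  "simple_graph E \<longleftrightarrow> (\<forall>e\<in>E. card e = 2)"

definition oriented_edges :: "'v::finite set set \<Rightarrow> ('v \<times> 'v) set" where
  "oriented_edges E = {(i, j). {i, j} \<in> E}"

definition adjacency :: "'v::finite set set \<Rightarrow> real ^ 'v ^ 'v" where
  "adjacency E = (\<chi> i j. if {i, j} \<in> E then 1 else 0)"

definition degree :: "'v::finite set set \<Rightarrow> 'v \<Rightarrow> nat" where
  "degree E v = card {w. {v, w} \<in> E}"

definition unitary_connection :: "'v::finite set set \<Rightarrow> ('v \<times> 'v \<Rightarrow> real) \<Rightarrow> bool" where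
  "unitary_connection E \<theta> \<longleftrightarrow> (\<forall>(i, j) \<in> oriented_edges E. \<theta> (j, i) = - \<theta> (i, j))"

definition degree_matrix :: "'v::finite set set \<Rightarrow> complex ^ 'v ^ 'v" where
  "degree_matrix E = (\<chi> i j. if i = j then of_nat (degree E i) else 0)"

definition connection_adjacency ::
    "'v::finite set set \<Rightarrow> ('v \<times> 'v \<Rightarrow> real) \<Rightarrow> complex ^ 'v ^ 'v" where
  "connection_adjacency E \<theta> =
     (\<chi> i j. if {i, j} \<in> E then exp (- (\<i> * of_real (\<theta> (i, j)))) else 0)"

definition connection_laplacian ::
    "'v::finite set set \<Rightarrow> ('v \<times> 'v \<Rightarrow> real) \<Rightarrow> complex ^ 'v ^ 'v" where
  "connection_laplacian E \<theta> = degree_matrix E - connection_adjacency E \<theta>"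

section \<open>The regularized least-squares problem\<close>

text \<open>The library's \<open>\<bullet>\<close> on \<open>complex ^ 'v\<close> is real-valued; this is the Hermitian product.\<close>

definition hermitian_inner :: "complex ^ 'v \<Rightarrow> complex ^ 'v \<Rightarrow> complex" where
  "hermitian_inner f h = (\<Sum>v\<in>UNIV. cnj (f $ v) * h $ v)"

text \<open>The energy is real, so the real part taken in the objective below discards nothing.\<close>

lemma connection_energy_real:
  assumes "unitary_connection E \<theta>"
  shows "hermitian_inner f (connection_laplacian E \<theta> *v f) \<in> \<real>"
proof -
  let ?L = "connection_laplacian E \<theta>"
  have herm: "cnj (?L $ i $ j) = ?L $ j $ i" for i j
  proof -
    have sym: "{j, i} = {i, j}"
      by (rule insert_commute)
    have "\<theta> (j, i) = - \<theta> (i, j)" if "{i, j} \<in> E"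
      using assms that unfolding unitary_connection_def oriented_edges_def by blast
    then show ?thesis
      unfolding connection_laplacian_def degree_matrix_def connection_adjacency_def sym
      by (simp add: exp_cnj sym)
  qed
  have "cnj (hermitian_inner f (?L *v f))
      = (\<Sum>i\<in>UNIV. \<Sum>j\<in>UNIV. f $ i * (?L $ j $ i * cnj (f $ j)))"
    unfolding hermitian_inner_def matrix_vector_mult_def
    by (simp add: sum_distrib_left herm)
  also have "\<dots> = (\<Sum>j\<in>UNIV. \<Sum>i\<in>UNIV. f $ i * (?L $ j $ i * cnj (f $ j)))"
    by (rule sum.swap)
  also have "\<dots> = hermitian_inner f (?L *v f)"
    unfolding hermitian_inner_def matrix_vector_mult_def
    by (simp add: sum_distrib_left mult_ac)
  finally show ?thesis
    unfolding Reals_cnj_iff .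
qed

definition objective ::
    "'v::finite set set \<Rightarrow> ('v \<times> 'v \<Rightarrow> real) \<Rightarrow> real \<Rightarrow> complex ^ 'v \<Rightarrow> complex ^ 'v \<Rightarrow> real" where
  "objective E \<theta> q g f =
     q * (norm (f - g))\<^sup>2 + Re (hermitian_inner f (connection_laplacian E \<theta> *v f))"

definition f_star ::
    "'v::finite set set \<Rightarrow> ('v \<times> 'v \<Rightarrow> real) \<Rightarrow> real \<Rightarrow> complex ^ 'v \<Rightarrow> complex ^ 'v" where
  "f_star E \<theta> q g = (THE f. is_arg_min (objective E \<theta> q g) (\<lambda>_. True) f)"

section \<open>Paths and parallel transport\<close>

definition psi_edge :: "('v \<times> 'v \<Rightarrow> real) \<Rightarrow> 'v \<times> 'v \<Rightarrow> complex \<Rightarrow> complex" where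
  "psi_edge \<theta> e z = exp (\<i> * of_real (\<theta> e)) * z"

primrec psi_path :: "('v \<times> 'v \<Rightarrow> real) \<Rightarrow> ('v \<times> 'v) list \<Rightarrow> complex \<Rightarrow> complex" where
  "psi_path \<theta> [] = id"
| "psi_path \<theta> (e # p) = psi_path \<theta> p \<circ> psi_edge \<theta> e"

lemma psi_path_append: "psi_path \<theta> (p @ r) = psi_path \<theta> r \<circ> psi_path \<theta> p"
  by (induction p) (simp_all add: comp_assoc)

definition path_reverse :: "('v \<times> 'v) list \<Rightarrow> ('v \<times> 'v) list" where
  "path_reverse p = rev (map prod.swap p)"

section \<open>The interrupted random walk\<close>

datatype 'v ext_node = Vertex (vertex_of: 'v) | \<Gamma>

text \<open>A stopped walk is continued by remaining at \<open>\<Gamma>\<close>.\<close>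

fun transition :: "'v::finite set set \<Rightarrow> real \<Rightarrow> 'v ext_node \<Rightarrow> 'v ext_node \<Rightarrow> real" where
  "transition E q (Vertex u) \<Gamma> = q / (real (degree E u) + q)"
| "transition E q (Vertex u) (Vertex v) = adjacency E $ u $ v / (real (degree E u) + q)"
| "transition E q \<Gamma> \<Gamma> = 1"
| "transition E q \<Gamma> (Vertex v) = 0"

text \<open>The last conjunct says that, given \<open>u\<^sub>0, \<dots>, u\<^sub>t\<close>, the node \<open>u\<^sub>t\<^sub>+\<^sub>1\<close> has distribution
  \<open>transition E q u\<^sub>t\<close>; it is written in product form so that histories of probability zero
  need no separate treatment.\<close>

definition interrupted_walk ::
    "'v::finite set set \<Rightarrow> real \<Rightarrow> 'v \<Rightarrow> 'w measure \<Rightarrow> (nat \<Rightarrow> 'w \<Rightarrow> 'v ext_node) \<Rightarrow> bool" where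
  "interrupted_walk E q i M u \<longleftrightarrow>
     prob_space M \<and>
     (\<forall>t. u t \<in> measurable M (count_space UNIV)) \<and>
     (AE \<omega> in M. u 0 \<omega> = Vertex i) \<and>
     (\<forall>t x. measure M {\<omega> \<in> space M. \<forall>s\<le>Suc t. u s \<omega> = x s} =
        measure M {\<omega> \<in> space M. \<forall>s\<le>t. u s \<omega> = x s} * transition E q (x t) (x (Suc t)))"

text \<open>The path of a trajectory up to its first visit to \<open>\<Gamma>\<close>. Trajectories that never reach
  \<open>\<Gamma>\<close>, which have probability zero when \<open>q > 0\<close>, get the dummy value \<open>[]\<close>.\<close>

definition walk_path :: "(nat \<Rightarrow> 'v ext_node) \<Rightarrow> ('v ext_node \<times> 'v ext_node) list" where
  "walk_path u =
     (if \<exists>l. u l = \<Gamma> then map (\<lambda>t. (u t, u (Suc t))) [0..<(LEAST l. u l = \<Gamma>)] else [])"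

definition path_law ::
    "'w measure \<Rightarrow> (nat \<Rightarrow> 'w \<Rightarrow> 'v ext_node) \<Rightarrow> ('v ext_node \<times> 'v ext_node) list measure" where
  "path_law M u = distr M (count_space UNIV) (\<lambda>\<omega>. walk_path (\<lambda>t. u t \<omega>))"

text \<open>For \<open>p = p\<^sub>\<Gamma> e\<^sub>\<Gamma>\<close> with \<open>e\<^sub>\<Gamma> = (j, \<Gamma>)\<close>: the path \<open>p\<^sub>\<Gamma>\<close>, whose edges join vertices of the
  graph, and the vertex \<open>j\<close>.\<close>

definition inner_path :: "('v ext_node \<times> 'v ext_node) list \<Rightarrow> ('v \<times> 'v) list" where
  "inner_path p = map (map_prod vertex_of vertex_of) (butlast p)"

definition last_vertex :: "('v ext_node \<times> 'v ext_node) list \<Rightarrow> 'v" where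
  "last_vertex p = vertex_of (fst (last p))"

end

theory Submission
  imports Defs
begin

text \<open>
  The objective is a strictly convex quadratic, and its minimizer is the unique solution \<open>f\<close> of
  \<open>(q + L) f = q g\<close> (lemmas \<open>regularized_system_solvable\<close> and \<open>f_star_eqI\<close>). Divided by \<open>d\<^sub>v + q\<close>,
  row \<open>v\<close> of this system reads
  \<open>f(v) = q / (d\<^sub>v + q) g(v) + (\<Sum>w\<sim>v. 1 / (d\<^sub>v + q) exp (- \<i> \<theta>(v, w)) f(w))\<close>, and the coefficients
  are the transition probabilities of the interrupted walk times the rotation from \<open>w\<close> back to \<open>v\<close>.
  So \<open>f\<close> is harmonic for the walk, twisted by the connection, with boundary value \<open>g\<close>.

  Harmonicity makes a martingale: up to time \<open>t\<close>, take \<open>f\<close> at the current node, carried back to the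
  start along the path, or the final payoff if the walk has been absorbed
  (\<open>history_value_martingale\<close>). Its expectation is always \<open>f(i)\<close>. It is bounded, since rotations
  preserve absolute values, and since the walk is absorbed almost surely (\<open>walk_absorbed_AE\<close>) it
  converges to the payoff of the whole path. Dominated convergence gives the claim.
\<close>

section \<open>The minimizer solves a linear system\<close>

lemma Re_hermitian_inner: "Re (hermitian_inner x y) = x \<bullet> y"
  by (simp add: hermitian_inner_def inner_vec_def inner_complex_def)

lemma connection_laplacian_mult:
  "(connection_laplacian E \<theta> *v x) $ v =
     of_nat (degree E v) * x $ v
     - (\<Sum>w\<in>UNIV. (if {v, w} \<in> E then exp (- (\<i> * of_real (\<theta> (v, w)))) else 0) * x $ w)"
proof -
  have "(\<Sum>w\<in>UNIV. (if v = w then of_nat (degree E v) else 0) * x $ w)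
      = of_nat (degree E v) * x $ v"
    by (simp add: if_distrib[where f = "\<lambda>c. c * _"] cong: if_cong)
  then show ?thesis
    by (simp add: connection_laplacian_def degree_matrix_def connection_adjacency_def
        matrix_vector_mult_def left_diff_distrib sum_subtractf)
qed

lemma connection_laplacian_self_adjoint:
  assumes "unitary_connection E \<theta>"
  shows "x \<bullet> (connection_laplacian E \<theta> *v y) = (connection_laplacian E \<theta> *v x) \<bullet> y"
proof -
  let ?L = "connection_laplacian E \<theta>"
  have herm: "cnj (?L $ i $ j) = ?L $ j $ i" for i j
  proof -
    have sym: "{j, i} = {i, j}"
      by (rule insert_commute)
    have "\<theta> (j, i) = - \<theta> (i, j)" if "{i, j} \<in> E"
      using assms that unfolding unitary_connection_def oriented_edges_def by blast
    then show ?thesis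
      unfolding connection_laplacian_def degree_matrix_def connection_adjacency_def sym
      by (simp add: exp_cnj sym)
  qed
  have "cnj (hermitian_inner x (?L *v y))
      = (\<Sum>i\<in>UNIV. \<Sum>j\<in>UNIV. x $ i * (?L $ j $ i * cnj (y $ j)))"
    unfolding hermitian_inner_def matrix_vector_mult_def
    by (simp add: sum_distrib_left herm)
  also have "\<dots> = (\<Sum>j\<in>UNIV. \<Sum>i\<in>UNIV. x $ i * (?L $ j $ i * cnj (y $ j)))"
    by (rule sum.swap)
  also have "\<dots> = hermitian_inner y (?L *v x)"
    unfolding hermitian_inner_def matrix_vector_mult_def
    by (simp add: sum_distrib_left mult_ac)
  finally have "Re (hermitian_inner x (?L *v y)) = Re (hermitian_inner y (?L *v x))"
    by (metis complex_cnj(1) cnj.sel(1))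
  then show ?thesis
    by (simp add: Re_hermitian_inner inner_commute)
qed

lemma sum_edge_indicator:
  "(\<Sum>w\<in>UNIV. if {v, w} \<in> E then c else 0) = real (degree E v) * c"
  by (simp add: degree_def sum.If_cases)

text \<open>The rotations do not change absolute values, so by \<open>2 a b \<le> a\<^sup>2 + b\<^sup>2\<close> the off-diagonal
  terms, summed over all oriented edges, are at most the diagonal ones.\<close>

lemma connection_laplacian_nonneg:
  "0 \<le> x \<bullet> (connection_laplacian E \<theta> *v x)"
proof -
  let ?a = "\<lambda>v w. if {v, w} \<in> E then exp (- (\<i> * of_real (\<theta> (v, w)))) else 0 :: complex"
  let ?b = "\<lambda>v w. if {v, w} \<in> E then (norm (x $ v))\<^sup>2 else 0"
  let ?c = "\<lambda>v w. if {v, w} \<in> E then (norm (x $ w))\<^sup>2 else 0"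
  have entry: "x $ v \<bullet> (?a v w * x $ w) \<le> (?b v w + ?c v w) / 2" for v w
  proof -
    have "x $ v \<bullet> (exp (- (\<i> * of_real (\<theta> (v, w)))) * x $ w)
        \<le> norm (x $ v) * norm (x $ w)"
      by (rule order_trans[OF norm_cauchy_schwarz]) (simp add: norm_mult)
    also have "\<dots> \<le> ((norm (x $ v))\<^sup>2 + (norm (x $ w))\<^sup>2) / 2"
      using sum_squares_bound[of "norm (x $ v)" "norm (x $ w)"] by simp
    finally show ?thesis by simp
  qed
  have swap: "(\<Sum>v\<in>UNIV. \<Sum>w\<in>UNIV. ?c v w) = (\<Sum>v\<in>UNIV. \<Sum>w\<in>UNIV. ?b v w)"
    by (subst sum.swap) (intro sum.cong refl, subst insert_commute, rule refl)
  have "(\<Sum>v\<in>UNIV. \<Sum>w\<in>UNIV. x $ v \<bullet> (?a v w * x $ w))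
      \<le> (\<Sum>v\<in>UNIV. \<Sum>w\<in>UNIV. (?b v w + ?c v w) / 2)"
    by (intro sum_mono entry)
  also have "\<dots> = (\<Sum>v\<in>UNIV. \<Sum>w\<in>UNIV. ?b v w)"
    unfolding sum_divide_distrib[symmetric] sum.distrib swap by simp
  also have "\<dots> = (\<Sum>v\<in>UNIV. real (degree E v) * (norm (x $ v))\<^sup>2)"
    by (simp only: sum_edge_indicator)
  finally have bound: "(\<Sum>v\<in>UNIV. \<Sum>w\<in>UNIV. x $ v \<bullet> (?a v w * x $ w))
      \<le> (\<Sum>v\<in>UNIV. real (degree E v) * (norm (x $ v))\<^sup>2)" .
  have diag: "x $ v \<bullet> (of_nat n * x $ v) = real n * (norm (x $ v))\<^sup>2" for v n
    by (simp add: inner_complex_def cmod_power2) (simp add: power2_eq_square algebra_simps)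
  have "x \<bullet> (connection_laplacian E \<theta> *v x)
      = (\<Sum>v\<in>UNIV. real (degree E v) * (norm (x $ v))\<^sup>2)
        - (\<Sum>v\<in>UNIV. \<Sum>w\<in>UNIV. x $ v \<bullet> (?a v w * x $ w))"
    unfolding inner_vec_def connection_laplacian_mult inner_diff_right inner_sum_right
      sum_subtractf diag ..
  with bound show ?thesis by simp
qed

text \<open>Pairing \<open>q x + L x = 0\<close> with \<open>x\<close> forces \<open>x = 0\<close>, as \<open>L\<close> is nonnegative; in finite
  dimension the injective map \<open>q + L\<close> is then onto.\<close>

lemma regularized_system_solvable:
  assumes "q > 0"
  obtains f where "q *\<^sub>R f + connection_laplacian E \<theta> *v f = q *\<^sub>R g"
proof -
  let ?L = "connection_laplacian E \<theta>"
  let ?T = "\<lambda>x. q *\<^sub>R x + ?L *v x"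
  have lin: "linear ?T"
  proof (rule linearI)
    show "?T (x + y) = ?T x + ?T y" for x y
      by (simp add: matrix_vector_right_distrib scaleR_add_right)
    show "?T (c *\<^sub>R x) = c *\<^sub>R ?T x" for c x
      by (simp add: vec_eq_iff connection_laplacian_mult scaleR_add_right scaleR_diff_right
          scaleR_sum_right mult.commute[of q])
  qed
  have "x = 0" if "?T x = 0" for x
  proof -
    have "0 = q * (x \<bullet> x) + x \<bullet> (?L *v x)"
      using arg_cong[OF that, of "\<lambda>y. x \<bullet> y"] by (simp add: inner_add_right)
    moreover have "0 \<le> q * (x \<bullet> x)"
      using assms by simp
    ultimately have "q * (x \<bullet> x) = 0"
      using connection_laplacian_nonneg[of x E \<theta>] by linarith
    with assms show ?thesis by simp
  qed
  then have "\<forall>x. ?T x = 0 \<longrightarrow> x = 0"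
    by (intro allI impI)
  then have "inj ?T"
    by (rule iffD2[OF linear_injective_0[OF lin]])
  with lin have "surj ?T"
    by (rule linear_injective_imp_surjective) (rule refl)
  then obtain f where "q *\<^sub>R g = ?T f"
    by (rule surjE)
  then show ?thesis
    by (rule that[OF sym])
qed

text \<open>The linear system says that the gradient of the objective vanishes at \<open>f\<close>. The objective
  then exceeds its value at \<open>f\<close> exactly by the quadratic form of the increment, which is at
  least \<open>q\<close> times its squared norm; so the minimizer exists and is unique.\<close>

lemma f_star_eqI:
  assumes "unitary_connection E \<theta>" and "q > 0"
    and f: "q *\<^sub>R f + connection_laplacian E \<theta> *v f = q *\<^sub>R g"
  shows "f_star E \<theta> q g = f"
proof -
  let ?L = "connection_laplacian E \<theta>"
  let ?J = "objective E \<theta> q g"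
  have expand: "?J (f + d) = ?J f + q * (d \<bullet> d) + d \<bullet> (?L *v d)" for d
  proof -
    have "?J (f + d) = q * ((f - g) \<bullet> (f - g)) + 2 * q * (d \<bullet> (f - g)) + q * (d \<bullet> d)
        + f \<bullet> (?L *v f) + 2 * (d \<bullet> (?L *v f)) + d \<bullet> (?L *v d)"
      using connection_laplacian_self_adjoint[OF assms(1), of f d]
      unfolding objective_def Re_hermitian_inner power2_norm_eq_inner
      by (simp add: matrix_vector_right_distrib inner_simps inner_commute[of "?L *v f" d]
          inner_commute[of f d] inner_commute[of g d] inner_commute[of g f] algebra_simps)
    moreover have "q * (d \<bullet> (f - g)) + d \<bullet> (?L *v f) = 0"
      using arg_cong[OF f, of "\<lambda>y. d \<bullet> y"] by (simp add: inner_simps algebra_simps)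
    ultimately show ?thesis
      unfolding objective_def Re_hermitian_inner power2_norm_eq_inner by simp
  qed
  have lower: "?J f + q * ((h - f) \<bullet> (h - f)) \<le> ?J h" for h
    using expand[of "h - f"] connection_laplacian_nonneg[of "h - f" E \<theta>] by simp
  have minimizer_iff: "is_arg_min ?J (\<lambda>_. True) h \<longleftrightarrow> h = f" for h
  proof
    assume "is_arg_min ?J (\<lambda>_. True) h"
    then have "?J h \<le> ?J f"
      by (auto simp: is_arg_min_def not_less)
    with lower[of h] have "q * ((h - f) \<bullet> (h - f)) \<le> 0"
      by linarith
    with \<open>q > 0\<close> have "(h - f) \<bullet> (h - f) \<le> 0"
      by (simp add: mult_le_0_iff)
    then have "(h - f) \<bullet> (h - f) = 0"
      using inner_ge_zero[of "h - f"] by linarith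
    then show "h = f" by simp
  next
    assume "h = f"
    moreover have "?J f \<le> ?J h'" for h'
      using lower[of h'] mult_nonneg_nonneg[of q "(h' - f) \<bullet> (h' - f)"] \<open>q > 0\<close>
        inner_ge_zero[of "h' - f"] by linarith
    ultimately show "is_arg_min ?J (\<lambda>_. True) h"
      by (simp add: is_arg_min_def not_less)
  qed
  show ?thesis
    unfolding f_star_def by (rule the_equality) (simp_all only: minimizer_iff)
qed

section \<open>One step of the walk\<close>

lemma UNIV_ext_node: "UNIV = insert \<Gamma> (range Vertex)"
  by (rule UNIV_eq_I) (metis ext_node.exhaust insertCI rangeI)

lemma finite_UNIV_ext_node: "finite (UNIV :: 'v::finite ext_node set)"
  unfolding UNIV_ext_node by simp

lemma sum_ext_node:
  fixes F :: "'v::finite ext_node \<Rightarrow> 'b::comm_monoid_add"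
  shows "(\<Sum>y\<in>UNIV. F y) = F \<Gamma> + (\<Sum>v\<in>UNIV. F (Vertex v))"
proof -
  have "(\<Sum>y\<in>range Vertex. F y) = (\<Sum>v\<in>UNIV. F (Vertex v))"
    by (subst sum.reindex) (auto intro: injI)
  then show ?thesis
    unfolding UNIV_ext_node by (subst sum.insert) auto
qed

lemma transition_sum_Vertex:
  "(\<Sum>v\<in>UNIV. transition E q (Vertex u) (Vertex v)) = real (degree E u) / (real (degree E u) + q)"
  using sum_edge_indicator[of u E "1 / (real (degree E u) + q)"]
  by (simp add: adjacency_def if_distrib[where f = "\<lambda>c. c / _"] cong: if_cong)

lemma transition_sum:
  assumes "q > 0"
  shows "(\<Sum>y\<in>UNIV. transition E q x y) = 1"
proof (cases x)
  case (Vertex u)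
  have "real (degree E u) + q \<noteq> 0"
    using assms by (metis add_nonneg_pos less_numeral_extra(3) of_nat_0_le_iff)
  then show ?thesis
    unfolding Vertex sum_ext_node transition_sum_Vertex
    by (simp add: add_divide_distrib[symmetric] add.commute)
qed (simp add: sum_ext_node)

text \<open>The linear system, divided by \<open>d\<^sub>v + q\<close>, says that \<open>f\<close> is harmonic for the walk with
  boundary value \<open>g\<close>: absorption pays \<open>g\<close> at the node just left, and moving on pays \<open>f\<close> at the
  new node, carried back along the edge.\<close>

lemma one_step_harmonic:
  assumes "unitary_connection E \<theta>" and "q > 0"
    and f: "q *\<^sub>R f + connection_laplacian E \<theta> *v f = q *\<^sub>R g"
  shows "complex_of_real (transition E q (Vertex v) \<Gamma>) * g $ v
    + (\<Sum>w\<in>UNIV. complex_of_real (transition E q (Vertex v) (Vertex w))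
        * psi_edge \<theta> (w, v) (f $ w)) = f $ v"
proof -
  let ?a = "\<lambda>w. if {v, w} \<in> E then exp (- (\<i> * of_real (\<theta> (v, w)))) else 0 :: complex"
  let ?d = "complex_of_real (real (degree E v) + q)"
  have "real (degree E v) + q \<noteq> 0"
    using assms by (metis add_nonneg_pos less_numeral_extra(3) of_nat_0_le_iff)
  then have d: "?d \<noteq> 0"
    by (simp only: of_real_eq_0_iff) simp
  have "complex_of_real (transition E q (Vertex v) (Vertex w)) * psi_edge \<theta> (w, v) (f $ w)
      = ?a w * f $ w / ?d" for w
  proof -
    have "\<theta> (w, v) = - \<theta> (v, w)" if "{v, w} \<in> E"
      using assms(1) that unfolding unitary_connection_def oriented_edges_def by blast
    then show ?thesis
      by (simp add: adjacency_def psi_edge_def)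
  qed
  then have "(\<Sum>w\<in>UNIV. complex_of_real (transition E q (Vertex v) (Vertex w))
      * psi_edge \<theta> (w, v) (f $ w)) = (\<Sum>w\<in>UNIV. ?a w * f $ w) / ?d"
    by (simp only: sum_divide_distrib)
  moreover have "of_real q * g $ v + (\<Sum>w\<in>UNIV. ?a w * f $ w) = ?d * f $ v"
    using arg_cong[OF f, of "\<lambda>x. x $ v"]
    by (simp add: connection_laplacian_mult scaleR_conv_of_real[where 'a = complex]
        algebra_simps)
  then have "of_real q * g $ v / ?d + (\<Sum>w\<in>UNIV. ?a w * f $ w) / ?d = f $ v"
    using d by (simp only: add_divide_distrib[symmetric]) simp
  ultimately show ?thesis
    by simp
qed

section \<open>The value of a history\<close>

abbreviation payoff ::
    "('v \<times> 'v \<Rightarrow> real) \<Rightarrow> complex ^ 'v \<Rightarrow> ('v ext_node \<times> 'v ext_node) list \<Rightarrow> complex" where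
  "payoff \<theta> g p \<equiv> psi_path \<theta> (path_reverse (inner_path p)) (g $ last_vertex p)"

lemma payoff_Cons:
  assumes "p \<noteq> []"
  shows "payoff \<theta> g ((Vertex v, Vertex w) # p) = psi_edge \<theta> (w, v) (payoff \<theta> g p)"
  using assms by (simp add: inner_path_def path_reverse_def last_vertex_def psi_path_append)

text \<open>The value of the nodes seen so far is the payoff once the walk is absorbed, and \<open>f\<close> at the
  current node carried back to the start before that. The recursion runs from the start of the
  walk, because transport back to the start applies the rotation of the first edge last. The value
  \<open>0\<close> for histories that are empty or start in \<open>\<Gamma>\<close> is a dummy.\<close>

fun history_value ::
    "('v \<times> 'v \<Rightarrow> real) \<Rightarrow> complex ^ 'v \<Rightarrow> complex ^ 'v \<Rightarrow> 'v ext_node list \<Rightarrow> complex" where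
  "history_value \<theta> f g [] = 0"
| "history_value \<theta> f g (\<Gamma> # xs) = 0"
| "history_value \<theta> f g [Vertex v] = f $ v"
| "history_value \<theta> f g (Vertex v # \<Gamma> # xs) = g $ v"
| "history_value \<theta> f g (Vertex v # Vertex w # xs) =
     psi_edge \<theta> (w, v) (history_value \<theta> f g (Vertex w # xs))"

lemma norm_history_value_le: "norm (history_value \<theta> f g xs) \<le> norm f + norm g"
proof (induction \<theta> f g xs rule: history_value.induct)
  case (3 \<theta> f g v)
  show ?case
    using Finite_Cartesian_Product.norm_nth_le[of f v] by (simp add: add_increasing2)
next
  case (4 \<theta> f g v xs)
  show ?case
    using Finite_Cartesian_Product.norm_nth_le[of g v] by (simp add: add_increasing)
qed (simp_all add: psi_edge_def norm_mult)

text \<open>Averaging over the next node leaves the value unchanged: an absorbed walk has a constant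
  value, and otherwise the claim reduces, edge by edge through the linear transport, to harmonicity
  of \<open>f\<close> at the current node.\<close>

lemma history_value_martingale:
  assumes "unitary_connection E \<theta>" and "q > 0"
    and "q *\<^sub>R f + connection_laplacian E \<theta> *v f = q *\<^sub>R g"
    and "xs \<noteq> []"
  shows "(\<Sum>y\<in>UNIV. of_real (transition E q (last xs) y) * history_value \<theta> f g (xs @ [y]))
    = history_value \<theta> f g xs"
  using assms
proof (induction \<theta> f g xs rule: history_value.induct)
  case (3 \<theta> f g v)
  then have "(\<Sum>w\<in>UNIV. complex_of_real (transition E q (Vertex v) (Vertex w))
        * psi_edge \<theta> (w, v) (f $ w))
      = f $ v - complex_of_real (transition E q (Vertex v) \<Gamma>) * g $ v"
    using one_step_harmonic[of E \<theta> q f g v] by (simp add: algebra_simps del: transition.simps)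
  then show ?case
    by (simp add: sum_ext_node del: transition.simps)
next
  case (4 \<theta> f g v xs)
  then have "(\<Sum>y\<in>UNIV. complex_of_real (transition E q (last (Vertex v # \<Gamma> # xs)) y)) = 1"
    by (metis of_real_1 of_real_sum transition_sum)
  then show ?case
    by (simp add: sum_distrib_right[symmetric])
next
  case (5 \<theta> f g v w xs)
  let ?c = "exp (\<i> * of_real (\<theta> (w, v)))"
  have "(\<Sum>y\<in>UNIV. of_real (transition E q (last (Vertex v # Vertex w # xs)) y)
        * history_value \<theta> f g ((Vertex v # Vertex w # xs) @ [y]))
      = ?c * (\<Sum>y\<in>UNIV. of_real (transition E q (last (Vertex w # xs)) y)
        * history_value \<theta> f g ((Vertex w # xs) @ [y]))"
    unfolding sum_distrib_left by (simp add: psi_edge_def mult.left_commute)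
  with 5 show ?case
    by (simp add: psi_edge_def)
qed simp_all

text \<open>This links the recursion on nodes to the payoff of the stopped path; induction on the
  absorption time peels off the first edge on both sides.\<close>

lemma history_value_absorbed:
  assumes "x l = \<Gamma>" and "\<forall>k<l. x k \<noteq> \<Gamma>" and "0 < l" and "l \<le> t"
  shows "history_value \<theta> f g (map x [0..<Suc t])
    = payoff \<theta> g (map (\<lambda>s. (x s, x (Suc s))) [0..<l])"
  using assms
proof (induction l arbitrary: x t)
  case 0
  then show ?case by simp
next
  case (Suc l)
  obtain v where v: "x 0 = Vertex v"
    using Suc.prems(2) by (cases "x 0") auto
  obtain t' where t: "t = Suc t'"
    using Suc.prems(4) by (cases t) auto
  have hist: "map x [0..<Suc t] = x 0 # x 1 # map (x \<circ> Suc \<circ> Suc) [0..<t']"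
    and hist': "map (x \<circ> Suc) [0..<Suc t'] = x 1 # map (x \<circ> Suc \<circ> Suc) [0..<t']"
    by (simp_all add: t map_upt_Suc comp_def del: upt_Suc)
  have path: "map (\<lambda>s. (x s, x (Suc s))) [0..<Suc l]
      = (x 0, x 1) # map (\<lambda>s. ((x \<circ> Suc) s, (x \<circ> Suc) (Suc s))) [0..<l]"
    by (simp add: map_upt_Suc comp_def del: upt_Suc)
  show ?case
  proof (cases l)
    case 0
    then have "x 1 = \<Gamma>"
      using Suc.prems(1) by simp
    then show ?thesis
      unfolding hist path by (simp add: 0 v inner_path_def path_reverse_def last_vertex_def)
  next
    case (Suc l')
    then obtain w where w: "x 1 = Vertex w"
      using Suc.prems(2) by (cases "x 1") auto
    have "history_value \<theta> f g (map (x \<circ> Suc) [0..<Suc t'])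
        = payoff \<theta> g (map (\<lambda>s. ((x \<circ> Suc) s, (x \<circ> Suc) (Suc s))) [0..<l])"
      using Suc.prems Suc t by (intro Suc.IH) auto
    then show ?thesis
      unfolding hist path hist' v w
      by (subst payoff_Cons) (simp_all add: Suc del: upt_Suc)
  qed
qed

section \<open>Expectations over the interrupted walk\<close>

abbreviation history :: "(nat \<Rightarrow> 'w \<Rightarrow> 'v ext_node) \<Rightarrow> nat \<Rightarrow> 'w \<Rightarrow> 'v ext_node list" where
  "history u t \<omega> \<equiv> map (\<lambda>s. u s \<omega>) [0..<Suc t]"

abbreviation histories :: "nat \<Rightarrow> 'v ext_node list set" where
  "histories t \<equiv> {xs. length xs = Suc t}"

lemma finite_histories: "finite (histories t :: 'v::finite ext_node list set)"
  using finite_lists_length_eq[OF finite_UNIV_ext_node, of "Suc t"] by simp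

lemma history_eq_iff:
  assumes "length xs = Suc t"
  shows "history u t \<omega> = xs \<longleftrightarrow> (\<forall>s\<le>t. u s \<omega> = xs ! s)"
  using assms by (auto simp: list_eq_iff_nth_eq less_Suc_eq_le nth_append simp del: upt_Suc)

lemma measurable_finite_range:
  assumes "finite A" and "\<And>\<omega>. \<omega> \<in> space M \<Longrightarrow> X \<omega> \<in> A"
    and "\<And>a. a \<in> A \<Longrightarrow> {\<omega> \<in> space M. X \<omega> = a} \<in> sets M"
  shows "X \<in> measurable M (count_space UNIV)"
proof (rule measurableI)
  fix B
  have "X -` B \<inter> space M = (\<Union>a\<in>A \<inter> B. {\<omega> \<in> space M. X \<omega> = a})"
    using assms(2) by auto
  also have "\<dots> \<in> sets M"
    using assms(1,3) by (intro sets.finite_UN) auto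
  finally show "X -` B \<inter> space M \<in> sets M" .
qed simp

lemma measurable_history:
  fixes u :: "nat \<Rightarrow> 'w \<Rightarrow> 'v::finite ext_node"
  assumes "\<And>t. u t \<in> measurable M (count_space UNIV)"
  shows "history u t \<in> measurable M (count_space UNIV)"
proof (rule measurable_finite_range[OF finite_histories])
  fix xs :: "'v ext_node list"
  assume xs: "xs \<in> histories t"
  note [measurable] = assms
  have "{\<omega> \<in> space M. \<forall>s\<le>t. u s \<omega> = xs ! s} \<in> sets M"
    by measurable
  then show "{\<omega> \<in> space M. history u t \<omega> = xs} \<in> sets M"
    using xs by (simp only: mem_Collect_eq history_eq_iff)
qed simp

text \<open>The path is a function of finitely many nodes once the absorption time is fixed, and that
  time takes countably many values.\<close>

lemma measurable_walk_path:
  fixes u :: "nat \<Rightarrow> 'w \<Rightarrow> 'v::finite ext_node"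
  assumes "\<And>t. u t \<in> measurable M (count_space UNIV)"
  shows "(\<lambda>\<omega>. walk_path (\<lambda>t. u t \<omega>)) \<in> measurable M (count_space UNIV)"
proof -
  note [measurable] = assms
  have path: "(\<lambda>\<omega>. map (\<lambda>t. (u t \<omega>, u (Suc t) \<omega>)) [0..<l]) \<in> measurable M (count_space UNIV)" for l
  proof -
    have "(\<lambda>\<omega>. map (\<lambda>t. (u t \<omega>, u (Suc t) \<omega>)) [0..<l])
        = (\<lambda>h. map (\<lambda>t. (h ! t, h ! Suc t)) [0..<l]) \<circ> history u l"
      by (auto simp del: upt_Suc)
    then show ?thesis
      by (simp only:) (rule measurable_comp[OF measurable_history[OF assms]], simp)
  qed
  have least: "(\<lambda>\<omega>. LEAST l. u l \<omega> = \<Gamma>) \<in> measurable M (count_space UNIV)"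
    by measurable
  have [measurable]:
    "(\<lambda>\<omega>. map (\<lambda>t. (u t \<omega>, u (Suc t) \<omega>)) [0..<(LEAST l. u l \<omega> = \<Gamma>)])
      \<in> measurable M (count_space UNIV)"
    by (rule measurable_compose_countable[OF path least])
  show ?thesis
    unfolding walk_path_def by measurable
qed

lemma integrable_history:
  fixes u :: "nat \<Rightarrow> 'w \<Rightarrow> 'v::finite ext_node"
    and F :: "'v ext_node list \<Rightarrow> 'b::{banach, second_countable_topology}"
  assumes "prob_space M" and "\<And>t. u t \<in> measurable M (count_space UNIV)"
  shows "integrable M (\<lambda>\<omega>. F (history u t \<omega>))"
proof -
  interpret prob_space M by fact
  have "norm (F (history u t \<omega>)) \<le> (\<Sum>xs\<in>histories t. norm (F xs))" for \<omega>
    using member_le_sum[of "history u t \<omega>" "histories t" "\<lambda>xs. norm (F xs)"]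
    by (simp add: finite_histories del: upt_Suc)
  moreover have "(\<lambda>\<omega>. F (history u t \<omega>)) \<in> borel_measurable M"
    by (rule measurable_compose[OF measurable_history[OF assms(2)]]) simp
  ultimately show ?thesis
    by (intro integrable_const_bound) auto
qed

lemma integral_history:
  fixes u :: "nat \<Rightarrow> 'w \<Rightarrow> 'v::finite ext_node"
    and F :: "'v ext_node list \<Rightarrow> 'b::{banach, second_countable_topology}"
  assumes "prob_space M" and "\<And>t. u t \<in> measurable M (count_space UNIV)"
  shows "(\<integral>\<omega>. F (history u t \<omega>) \<partial>M)
    = (\<Sum>xs\<in>histories t. measure M {\<omega> \<in> space M. history u t \<omega> = xs} *\<^sub>R F xs)"
proof -
  interpret prob_space M by fact
  note [measurable] = measurable_history[OF assms(2)]
  have "(\<integral>\<omega>. F (history u t \<omega>) \<partial>M)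
      = (\<integral>\<omega>. (\<Sum>xs\<in>histories t. indicator {\<omega> \<in> space M. history u t \<omega> = xs} \<omega> *\<^sub>R F xs) \<partial>M)"
  proof (rule Bochner_Integration.integral_cong[OF refl])
    fix \<omega>
    assume "\<omega> \<in> space M"
    then have "(\<Sum>xs\<in>histories t. indicator {\<omega> \<in> space M. history u t \<omega> = xs} \<omega> *\<^sub>R F xs)
        = (\<Sum>xs\<in>histories t. if xs = history u t \<omega> then F xs else 0)"
      by (intro sum.cong) (auto simp: indicator_def simp del: upt_Suc)
    then show "F (history u t \<omega>)
        = (\<Sum>xs\<in>histories t. indicator {\<omega> \<in> space M. history u t \<omega> = xs} \<omega> *\<^sub>R F xs)"
      by (simp add: finite_histories del: upt_Suc)
  qed
  also have "\<dots> = (\<Sum>xs\<in>histories t. measure M {\<omega> \<in> space M. history u t \<omega> = xs} *\<^sub>R F xs)"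
    by (subst Bochner_Integration.integral_sum)
      (auto intro!: integrable_scaleR_left integrable_real_indicator
        simp: emeasure_eq_measure simp del: upt_Suc)
  finally show ?thesis .
qed

text \<open>The Markov property in integrated form. A history up to time \<open>t + 1\<close> is one up to
  time \<open>t\<close> with a node appended, and the product formula defining the walk factors its probability, so the
  last node can be summed out first.\<close>

lemma integral_history_Suc:
  fixes u :: "nat \<Rightarrow> 'w \<Rightarrow> 'v::finite ext_node"
    and F :: "'v ext_node list \<Rightarrow> 'b::{banach, second_countable_topology}"
  assumes walk: "interrupted_walk E q i M u"
  shows "(\<integral>\<omega>. F (history u (Suc t) \<omega>) \<partial>M)
    = (\<integral>\<omega>. (\<Sum>y\<in>UNIV. transition E q (u t \<omega>) y *\<^sub>R F (history u t \<omega> @ [y])) \<partial>M)"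
proof -
  have M: "prob_space M" and u: "\<And>t. u t \<in> measurable M (count_space UNIV)"
    using walk by (auto simp: interrupted_walk_def)
  have step: "measure M {\<omega> \<in> space M. history u (Suc t) \<omega> = xs @ [y]}
      = measure M {\<omega> \<in> space M. history u t \<omega> = xs} * transition E q (last xs) y"
    if xs: "xs \<in> histories t" for xs y
  proof -
    let ?x = "\<lambda>s. (xs @ [y]) ! s"
    have "measure M {\<omega> \<in> space M. \<forall>s\<le>Suc t. u s \<omega> = ?x s}
        = measure M {\<omega> \<in> space M. \<forall>s\<le>t. u s \<omega> = ?x s} * transition E q (?x t) (?x (Suc t))"
      using walk unfolding interrupted_walk_def by blast
    moreover have "?x t = last xs" "?x (Suc t) = y"
      using xs last_conv_nth[of xs] by (cases "xs = []"; simp add: nth_append)+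
    moreover have "{\<omega> \<in> space M. \<forall>s\<le>t. u s \<omega> = ?x s} = {\<omega> \<in> space M. history u t \<omega> = xs}"
      using xs by (subst history_eq_iff) (auto simp: nth_append)
    moreover have "{\<omega> \<in> space M. \<forall>s\<le>Suc t. u s \<omega> = ?x s}
        = {\<omega> \<in> space M. history u (Suc t) \<omega> = xs @ [y]}"
      using xs by (subst history_eq_iff) auto
    ultimately show ?thesis
      by (simp only:)
  qed
  have append: "bij_betw (\<lambda>(xs, y). xs @ [y]) (histories t \<times> UNIV)
      (histories (Suc t) :: 'v ext_node list set)"
  proof (rule bij_betwI')
    fix ys :: "'v ext_node list"
    assume "ys \<in> histories (Suc t)"
    then have "length ys = Suc (Suc t)" "ys \<noteq> []"
      by auto
    then show "\<exists>z\<in>histories t \<times> UNIV. ys = (case z of (xs, y) \<Rightarrow> xs @ [y])"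
      by (intro bexI[of _ "(butlast ys, last ys)"]) simp_all
  qed auto
  have "(\<integral>\<omega>. F (history u (Suc t) \<omega>) \<partial>M)
      = (\<Sum>(xs, y)\<in>histories t \<times> UNIV.
          measure M {\<omega> \<in> space M. history u (Suc t) \<omega> = xs @ [y]} *\<^sub>R F (xs @ [y]))"
    using sum.reindex_bij_betw[OF append, symmetric,
        of "\<lambda>xs. measure M {\<omega> \<in> space M. history u (Suc t) \<omega> = xs} *\<^sub>R F xs"]
    by (simp only: integral_history[OF M u, where F = F and t = "Suc t"] case_prod_unfold)
  also have "\<dots> = (\<Sum>xs\<in>histories t. \<Sum>y\<in>UNIV.
          measure M {\<omega> \<in> space M. history u (Suc t) \<omega> = xs @ [y]} *\<^sub>R F (xs @ [y]))"
    by (rule sum.cartesian_product[symmetric])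
  also have "\<dots> = (\<Sum>xs\<in>histories t. measure M {\<omega> \<in> space M. history u t \<omega> = xs} *\<^sub>R
          (\<Sum>y\<in>UNIV. transition E q (last xs) y *\<^sub>R F (xs @ [y])))"
    unfolding scaleR_sum_right by (intro sum.cong refl) (simp only: step scaleR_scaleR)
  also have "\<dots> = (\<integral>\<omega>. (\<Sum>y\<in>UNIV. transition E q (last (history u t \<omega>)) y
          *\<^sub>R F (history u t \<omega> @ [y])) \<partial>M)"
    by (rule integral_history[OF M u, symmetric, where t = t
          and F = "\<lambda>xs. \<Sum>y\<in>UNIV. transition E q (last xs) y *\<^sub>R F (xs @ [y])"])
  finally show ?thesis
    by simp
qed

text \<open>From every vertex the walk is absorbed with probability at least \<open>q / (n + q)\<close>, where \<open>n\<close>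
  is the number of vertices, so the probability of survival decays geometrically.\<close>

lemma walk_absorbed_AE:
  fixes u :: "nat \<Rightarrow> 'w \<Rightarrow> 'v::finite ext_node"
  assumes "q > 0" and walk: "interrupted_walk E q i M u"
  shows "AE \<omega> in M. \<exists>l. u l \<omega> = \<Gamma>"
proof -
  have M: "prob_space M" and u [measurable]: "\<And>t. u t \<in> measurable M (count_space UNIV)"
    using walk by (auto simp: interrupted_walk_def)
  interpret prob_space M by (rule M)
  note [measurable] = measurable_history[OF u]
  define r where "r = real CARD('v) / (real CARD('v) + q)"
  have r: "0 \<le> r" "r < 1"
    using \<open>q > 0\<close> by (auto simp: r_def)
  let ?F = "\<lambda>xs. if \<Gamma> \<in> set xs then 0 else 1 :: real"
  have survive: "(\<Sum>y\<in>UNIV. transition E q (u t \<omega>) y *\<^sub>R ?F (history u t \<omega> @ [y]))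
      \<le> r * ?F (history u t \<omega>)" for t \<omega>
  proof (cases "\<Gamma> \<in> set (history u t \<omega>)")
    case False
    then have "u t \<omega> \<noteq> \<Gamma>"
      by auto
    then obtain v where v: "u t \<omega> = Vertex v"
      by (cases "u t \<omega>") auto
    have "real (degree E v) \<le> real CARD('v)"
      unfolding degree_def by (intro of_nat_mono card_mono) auto
    then have "real (degree E v) / (real (degree E v) + q) \<le> r"
      using \<open>q > 0\<close> by (simp add: r_def field_simps add_nonneg_pos)
    moreover have "(\<Sum>y\<in>UNIV. transition E q (u t \<omega>) y *\<^sub>R ?F (history u t \<omega> @ [y]))
        = (\<Sum>v'\<in>UNIV. transition E q (Vertex v) (Vertex v'))"
      using False unfolding sum_ext_node v by (simp del: upt_Suc transition.simps)
    ultimately show ?thesis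
      using False unfolding transition_sum_Vertex by (simp del: upt_Suc)
  qed (simp del: upt_Suc)
  have decay: "(\<integral>\<omega>. ?F (history u t \<omega>) \<partial>M) \<le> r ^ t" for t
  proof (induction t)
    case 0
    have "(\<integral>\<omega>. ?F (history u 0 \<omega>) \<partial>M) \<le> (\<integral>\<omega>. 1 \<partial>M)"
      by (intro integral_mono integrable_history[OF M u, where F = ?F]) auto
    then show ?case
      by (simp add: prob_space)
  next
    case (Suc t)
    have "(\<integral>\<omega>. ?F (history u (Suc t) \<omega>) \<partial>M)
        = (\<integral>\<omega>. (\<Sum>y\<in>UNIV. transition E q (u t \<omega>) y *\<^sub>R ?F (history u t \<omega> @ [y])) \<partial>M)"
      by (rule integral_history_Suc[OF walk, where F = ?F])
    also have "\<dots> \<le> (\<integral>\<omega>. r * ?F (history u t \<omega>) \<partial>M)"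
    proof (rule integral_mono)
      show "integrable M
          (\<lambda>\<omega>. \<Sum>y\<in>UNIV. transition E q (u t \<omega>) y *\<^sub>R ?F (history u t \<omega> @ [y]))"
        using integrable_history[OF M u, where t = t
            and F = "\<lambda>xs. \<Sum>y\<in>UNIV. transition E q (last xs) y *\<^sub>R ?F (xs @ [y])"]
        by simp
      show "integrable M (\<lambda>\<omega>. r * ?F (history u t \<omega>))"
        by (rule integrable_history[OF M u, where F = "\<lambda>xs. r * ?F xs"])
    qed (rule survive)
    also have "\<dots> \<le> r ^ Suc t"
      using Suc.IH r by (simp add: mult_left_mono del: upt_Suc)
    finally show ?case .
  qed
  let ?N = "{\<omega> \<in> space M. \<forall>l. u l \<omega> \<noteq> \<Gamma>}"
  have N: "?N \<in> sets M"
    by measurable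
  have "measure M ?N \<le> r ^ t" for t
  proof -
    have "measure M ?N = (\<integral>\<omega>. indicator ?N \<omega> \<partial>M)"
      using N by simp
    also have "\<dots> \<le> (\<integral>\<omega>. ?F (history u t \<omega>) \<partial>M)"
    proof (rule integral_mono)
      show "integrable M (indicator ?N :: 'w \<Rightarrow> real)"
        using N by (simp add: integrable_indicator_iff emeasure_eq_measure)
      show "integrable M (\<lambda>\<omega>. ?F (history u t \<omega>))"
        by (rule integrable_history[OF M u, where F = ?F])
      show "indicator ?N \<omega> \<le> ?F (history u t \<omega>)" for \<omega>
        by (auto simp: indicator_def image_iff simp del: upt_Suc) metis
    qed
    finally show ?thesis
      using decay[of t] by simp
  qed
  moreover have "(\<lambda>t. r ^ t) \<longlonglongrightarrow> 0"
    using r by (intro LIMSEQ_power_zero) simp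
  ultimately have "measure M ?N \<le> 0"
    by (intro LIMSEQ_le_const) auto
  then have "emeasure M ?N = 0"
    by (simp add: emeasure_eq_measure measure_le_0_iff)
  then show ?thesis
    using N by (subst AE_iff_measurable[OF N]) auto
qed

section \<open>The minimizer as an expectation over paths\<close>

theorem proposition2p2:
  fixes E :: "'v::finite set set"
    and \<theta> :: "'v \<times> 'v \<Rightarrow> real"
    and q :: real
    and g :: "complex ^ 'v"
    and i :: 'v
    and M :: "'w measure"
    and u :: "nat \<Rightarrow> 'w \<Rightarrow> 'v ext_node"
  assumes "simple_graph E"
    and "unitary_connection E \<theta>"
    and "q > 0"
    and "interrupted_walk E q i M u"
  shows "f_star E \<theta> q g $ i =
    (\<integral>p. psi_path \<theta> (path_reverse (inner_path p)) (g $ last_vertex p) \<partial>path_law M u)"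
proof -
  have M: "prob_space M" and u: "\<And>t. u t \<in> measurable M (count_space UNIV)"
    and start: "AE \<omega> in M. u 0 \<omega> = Vertex i"
    using assms(4) by (auto simp: interrupted_walk_def)
  interpret prob_space M by (rule M)
  note [measurable] = u measurable_history[OF u]
  obtain f where f: "q *\<^sub>R f + connection_laplacian E \<theta> *v f = q *\<^sub>R g"
    using regularized_system_solvable[OF \<open>q > 0\<close>] .
  let ?V = "\<lambda>t \<omega>. history_value \<theta> f g (history u t \<omega>)"
  let ?P = "\<lambda>\<omega>. payoff \<theta> g (walk_path (\<lambda>t. u t \<omega>))"
  have P [measurable]: "?P \<in> borel_measurable M"
    by (rule measurable_compose[OF measurable_walk_path[OF u]]) simp
  have V [measurable]: "?V t \<in> borel_measurable M" for t
    by (rule measurable_compose[OF measurable_history[OF u]]) simp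
  have const: "(\<integral>\<omega>. ?V t \<omega> \<partial>M) = f $ i" for t
  proof (induction t)
    case 0
    have "(\<integral>\<omega>. ?V 0 \<omega> \<partial>M) = (\<integral>\<omega>. f $ i \<partial>M)"
      using start V[of 0] by (intro integral_cong_AE) auto
    then show ?case
      by (simp add: prob_space)
  next
    case (Suc t)
    have "(\<Sum>y\<in>UNIV. transition E q (u t \<omega>) y *\<^sub>R history_value \<theta> f g (history u t \<omega> @ [y]))
        = ?V t \<omega>" for \<omega>
      using history_value_martingale[OF assms(2,3) f, of "history u t \<omega>"]
      by (simp add: scaleR_conv_of_real)
    then show ?case
      unfolding integral_history_Suc[OF assms(4), where F = "history_value \<theta> f g"]
      by (simp only: Suc.IH)
  qed
  have "AE \<omega> in M. (\<lambda>t. ?V t \<omega>) \<longlonglongrightarrow> ?P \<omega>"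
    using start walk_absorbed_AE[OF assms(3,4)]
  proof eventually_elim
    case (elim \<omega>)
    define l where "l = (LEAST l. u l \<omega> = \<Gamma>)"
    have l: "u l \<omega> = \<Gamma>" "\<forall>k<l. u k \<omega> \<noteq> \<Gamma>"
      using LeastI_ex[OF elim(2)] not_less_Least[of _ "\<lambda>l. u l \<omega> = \<Gamma>"]
      unfolding l_def by blast+
    with elim(1) have "0 < l"
      by (intro gr0I) auto
    moreover have "walk_path (\<lambda>t. u t \<omega>) = map (\<lambda>s. (u s \<omega>, u (Suc s) \<omega>)) [0..<l]"
      using elim(2) by (simp add: walk_path_def l_def)
    ultimately have "?V t \<omega> = ?P \<omega>" if "l \<le> t" for t
      using history_value_absorbed[of "\<lambda>s. u s \<omega>", OF l _ that] by simp
    then show ?case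
      by (intro tendsto_eventually eventually_sequentiallyI[of l]) (simp del: upt_Suc)
  qed
  then have "(\<lambda>t. \<integral>\<omega>. ?V t \<omega> \<partial>M) \<longlonglongrightarrow> (\<integral>\<omega>. ?P \<omega> \<partial>M)"
    by (intro integral_dominated_convergence[where w = "\<lambda>_. norm f + norm g"])
      (auto simp: norm_history_value_le simp del: upt_Suc)
  then have "(\<integral>\<omega>. ?P \<omega> \<partial>M) = f $ i"
    unfolding const by (simp add: LIMSEQ_const_iff)
  moreover have "(\<integral>p. payoff \<theta> g p \<partial>path_law M u) = (\<integral>\<omega>. ?P \<omega> \<partial>M)"
    unfolding path_law_def by (rule integral_distr[OF measurable_walk_path[OF u]]) simp
  ultimately show ?thesis
    using f_star_eqI[OF assms(2,3) f] by simp
qed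

end
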